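(* Let $\mathbf{k}$ be a field of characteristic $0$ with identity element $1$, let $A$ be a vector space over $\mathbf{k}$ with two binary operations $\cdot$ and $\circ$, and let $1_A\in A$. On $A[t,t^{-1}]:=A\otimes\mathbf{k}[t,t^{-1}]$, writing $at^m:=a\otimes t^m$, define binary operations by $$(at^m)\cdot(bt^n)=(a\cdot b)t^{m+n},\qquad [at^m,bt^n]=m(a\circ b)t^{m+n-1}-n(b\circ a)t^{m+n-1}$$ for all $a,b\in A$, $m,n\in\mathbb{Z}$. Then $(A[t,t^{-1}],\cdot,[\cdot,\cdot])$ is a Jacobi algebra with identity element $1_A\otimes 1$ if and only if $(A,\cdot,\circ)$ is a Jacobi Novikov-Poisson algebra (with identity element $1_A$ of $(A,\cdot)$).
   Context: All vector spaces and algebras are over $\mathbf{k}$; binary operations are bilinear. A Novikov algebra $(A,\circ)$ is a vector space with a binary operation satisfying $(a\circ b)\circ c-a\circ(b\circ c)=(b\circ a)\circ c-b\circ(a\circ c)$ and $(a\circ b)\circ c=(a\circ c)\circ b$ for all $a,b,c\in A$. A Jacobi Novikov-Poisson algebra is a triple $(A,\cdot,\circ)$ where $(A,\cdot)$ is a unital commutative associative algebra with identity $1_A$, $(A,\circ)$ is a Novikov algebra, and for all $a,b,c\in A$: $(a\cdot b)\circ c=a\cdot(b\circ c)$ and $c\circ(a\cdot b)=(c\circ a)\cdot b+a\cdot(c\circ b)-a\cdot b\cdot(c\circ 1_A)$. A Jacobi algebra is a triple $(J,\cdot,[\cdot,\cdot])$ where $(J,\cdot)$ is a unital commutative associative algebra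 with identity $1_J$, $(J,[\cdot,\cdot])$ is a Lie algebra, and $[a,b\cdot c]=[a,b]\cdot c+b\cdot[a,c]+b\cdot c\cdot[1_J,a]$ for all $a,b,c\in J$. *)

theory Defs
  imports Complex_Main "HOL-Library.Poly_Mapping"
begin

locale bilinear_operation = vector_space scale
  for scale :: "'k::field \<Rightarrow> 'a::ab_group_add \<Rightarrow> 'a" +
  fixes f :: "'a \<Rightarrow> 'a \<Rightarrow> 'a"
  assumes linear_right: "Vector_Spaces.linear scale scale (\<lambda>y. f x y)"
    and linear_left: "Vector_Spaces.linear scale scale (\<lambda>x. f x y)"

locale unital_comm_algebra = bilinear_operation scale mul
  for scale :: "'k::field \<Rightarrow> 'a::ab_group_add \<Rightarrow> 'a" and mul :: "'a \<Rightarrow> 'a \<Rightarrow> 'a" +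
  fixes one :: 'a
  assumes mul_assoc: "mul (mul a b) c = mul a (mul b c)"
    and mul_comm: "mul a b = mul b a"
    and mul_one: "mul one a = a"

locale lie_algebra = bilinear_operation scale br
  for scale :: "'k::field \<Rightarrow> 'a::ab_group_add \<Rightarrow> 'a" and br :: "'a \<Rightarrow> 'a \<Rightarrow> 'a" +
  assumes br_self: "br a a = 0"
    and jacobi_identity: "br a (br b c) + br b (br c a) + br c (br a b) = 0"

locale novikov_algebra = bilinear_operation scale nov
  for scale :: "'k::field \<Rightarrow> 'a::ab_group_add \<Rightarrow> 'a" and nov :: "'a \<Rightarrow> 'a \<Rightarrow> 'a" +
  assumes left_symmetric:
      "nov (nov a b) c - nov a (nov b c) = nov (nov b a) c - nov b (nov a c)"
    and right_commutative: "nov (nov a b) c = nov (nov a c) b"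

locale jacobi_novikov_poisson_algebra =
  unital_comm_algebra scale mul one + novikov_algebra scale nov
  for scale :: "'k::field \<Rightarrow> 'a::ab_group_add \<Rightarrow> 'a"
    and mul nov :: "'a \<Rightarrow> 'a \<Rightarrow> 'a" and one :: 'a +
  assumes mul_nov: "nov (mul a b) c = mul a (nov b c)"
    and nov_mul:
      "nov c (mul a b) = mul (nov c a) b + mul a (nov c b) - mul (mul a b) (nov c one)"

locale jacobi_algebra =
  unital_comm_algebra scale mul one + lie_algebra scale br
  for scale :: "'k::field \<Rightarrow> 'a::ab_group_add \<Rightarrow> 'a"
    and mul br :: "'a \<Rightarrow> 'a \<Rightarrow> 'a" and one :: 'a +
  assumes br_mul: "br a (mul b c) = mul (br a b) c + mul b (br a c) + mul (mul b c) (br one a)"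


text \<open>
  The space \<open>A \<otimes> k[t, t\<^sup>-\<^sup>1]\<close> is modelled by the finitely supported functions from \<open>int\<close> to \<open>A\<close>,
  the value at \<open>m\<close> being the coefficient of \<open>t\<^sup>m\<close>. With \<open>A = k\<close> this gives \<open>k[t, t\<^sup>-\<^sup>1]\<close> itself; lemmas
  \<open>laurent_tensor_bilinear\<close> and \<open>laurent_tensor_universal\<close> below show that this is the
  tensor product.
\<close>

type_synonym 'a laurent = "int \<Rightarrow>\<^sub>0 'a"

definition laurent_scale :: "('k::field \<Rightarrow> 'a::ab_group_add \<Rightarrow> 'a) \<Rightarrow> 'k \<Rightarrow> 'a laurent \<Rightarrow> 'a laurent"
  where "laurent_scale scale c p = Poly_Mapping.map (scale c) p"

definition laurent_tensor :: "('k::field \<Rightarrow> 'a::ab_group_add \<Rightarrow> 'a) \<Rightarrow> 'a \<Rightarrow> 'k laurent \<Rightarrow> 'a laurent"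
  where "laurent_tensor scale a q = Poly_Mapping.map (\<lambda>c. scale c a) q"

text \<open>The monomial \<open>a t\<^sup>m = a \<otimes> t\<^sup>m\<close> (see \<open>laurent_tensor_monom\<close>).\<close>

definition laurent_monom :: "'a::zero \<Rightarrow> int \<Rightarrow> 'a laurent"
  where "laurent_monom a m = Poly_Mapping.single m a"

text \<open>
  The two operations are the bilinear extensions of their values on monomials; see
  \<open>laurent_mult_monom\<close>, \<open>laurent_bracket_monom\<close> and the bilinearity lemmas below.
\<close>

definition laurent_mult :: "('a::ab_group_add \<Rightarrow> 'a \<Rightarrow> 'a) \<Rightarrow> 'a laurent \<Rightarrow> 'a laurent \<Rightarrow> 'a laurent"
  where "laurent_mult mul p q =
    (\<Sum>m\<in>Poly_Mapping.keys p. \<Sum>n\<in>Poly_Mapping.keys q.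
       laurent_monom (mul (Poly_Mapping.lookup p m) (Poly_Mapping.lookup q n)) (m + n))"

definition laurent_bracket ::
    "('k::field \<Rightarrow> 'a::ab_group_add \<Rightarrow> 'a) \<Rightarrow> ('a \<Rightarrow> 'a \<Rightarrow> 'a) \<Rightarrow> 'a laurent \<Rightarrow> 'a laurent \<Rightarrow> 'a laurent"
  where "laurent_bracket scale nov p q =
    (\<Sum>m\<in>Poly_Mapping.keys p. \<Sum>n\<in>Poly_Mapping.keys q.
       laurent_scale scale (of_int m)
         (laurent_monom (nov (Poly_Mapping.lookup p m) (Poly_Mapping.lookup q n)) (m + n - 1))
     - laurent_scale scale (of_int n)
         (laurent_monom (nov (Poly_Mapping.lookup q n) (Poly_Mapping.lookup p m)) (m + n - 1)))"


lemma lookup_laurent_scale: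
  assumes "vector_space scale"
  shows "Poly_Mapping.lookup (laurent_scale scale c p) m = scale c (Poly_Mapping.lookup p m)"
proof -
  interpret vector_space scale by fact
  show ?thesis by (simp add: laurent_scale_def map.rep_eq when_def)
qed

lemma lookup_laurent_tensor:
  assumes "vector_space scale"
  shows "Poly_Mapping.lookup (laurent_tensor scale a q) m = scale (Poly_Mapping.lookup q m) a"
proof -
  interpret vector_space scale by fact
  show ?thesis by (simp add: laurent_tensor_def map.rep_eq when_def)
qed

lemma vector_space_laurent:
  assumes "vector_space scale"
  shows "vector_space (laurent_scale scale)"
proof -
  interpret vector_space scale by fact
  show ?thesis
    by unfold_locales
      (auto intro!: poly_mapping_eqI
        simp: lookup_laurent_scale[OF assms] lookup_add scale_right_distrib scale_left_distrib)
qed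

lemma laurent_tensor_monom:
  assumes "vector_space scale"
  shows "laurent_tensor scale a (laurent_monom 1 m) = laurent_monom a m"
proof -
  interpret vector_space scale by fact
  show ?thesis
    by (auto intro!: poly_mapping_eqI
        simp: lookup_laurent_tensor[OF assms] laurent_monom_def lookup_single when_def)
qed

lemma laurent_tensor_bilinear:
  assumes "vector_space scale"
  shows "Vector_Spaces.linear (laurent_scale (*)) (laurent_scale scale) (\<lambda>q. laurent_tensor scale a q)"
    and "Vector_Spaces.linear scale (laurent_scale scale) (\<lambda>a. laurent_tensor scale a q)"
proof -
  interpret vector_space scale by fact
  have K: "vector_space ((*) :: 'a \<Rightarrow> 'a \<Rightarrow> 'a)"
    by unfold_locales (auto simp: algebra_simps)
  note [simp] = lookup_laurent_scale[OF assms] lookup_laurent_scale[OF K]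
    lookup_laurent_tensor[OF assms]
  show "Vector_Spaces.linear (laurent_scale (*)) (laurent_scale scale) (\<lambda>q. laurent_tensor scale a q)"
    unfolding Vector_Spaces.linear_def module_hom_def module_hom_axioms_def
    using vector_space_laurent[OF assms] vector_space_laurent[OF K]
    by (auto intro!: poly_mapping_eqI simp: lookup_add scale_left_distrib module_iff_vector_space)
  show "Vector_Spaces.linear scale (laurent_scale scale) (\<lambda>a. laurent_tensor scale a q)"
    unfolding Vector_Spaces.linear_def module_hom_def module_hom_axioms_def
    using vector_space_laurent[OF assms] assms
    by (auto intro!: poly_mapping_eqI
        simp: lookup_add scale_right_distrib module_iff_vector_space mult.commute)
qed

lemma laurent_eq_sum_monom:
  "p = (\<Sum>m\<in>Poly_Mapping.keys p. laurent_monom (Poly_Mapping.lookup p m) m)"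
  by (rule poly_mapping_eqI)
    (auto simp: lookup_sum laurent_monom_def lookup_single when_def in_keys_iff)

lemma laurent_tensor_universal:
  fixes scale :: "'k::field \<Rightarrow> 'a::ab_group_add \<Rightarrow> 'a"
    and scaleC :: "'k \<Rightarrow> 'c::ab_group_add \<Rightarrow> 'c"
  assumes right: "\<And>a. Vector_Spaces.linear (laurent_scale (*)) scaleC (\<lambda>q. f a q)"
    and left: "\<And>q. Vector_Spaces.linear scale scaleC (\<lambda>a. f a q)"
  shows "\<exists>!g. Vector_Spaces.linear (laurent_scale scale) scaleC g \<and>
    (\<forall>a q. g (laurent_tensor scale a q) = f a q)"
proof -
  interpret left: Vector_Spaces.linear scale scaleC "\<lambda>a. f a q" for q by (rule left)
  interpret right: Vector_Spaces.linear "laurent_scale ((*) :: 'k \<Rightarrow> _)" scaleC "\<lambda>q. f a q" for a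
    by (rule right)
  have VA: "vector_space scale" and VC: "vector_space scaleC"
    using left[of 0] by (auto simp: Vector_Spaces.linear_def)
  have K: "vector_space ((*) :: 'k \<Rightarrow> 'k \<Rightarrow> 'k)"
    by unfold_locales (auto simp: algebra_simps)
  define g where "g p = (\<Sum>m\<in>Poly_Mapping.keys p. f (Poly_Mapping.lookup p m) (laurent_monom 1 m))" for p
  have g_sup: "g p = (\<Sum>m\<in>S. f (Poly_Mapping.lookup p m) (laurent_monom 1 m))"
    if "finite S" "Poly_Mapping.keys p \<subseteq> S" for p S
    unfolding g_def by (rule sum.mono_neutral_left) (use that in \<open>auto simp: in_keys_iff left.zero\<close>)
  have g_add: "g (p + q) = g p + g q" for p q
  proof -
    let ?S = "Poly_Mapping.keys p \<union> Poly_Mapping.keys q"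
    have "finite ?S" by simp
    note * = g_sup[OF this]
    show ?thesis
      by (simp add: *[of p] *[of q] *[of "p + q"] keys_add lookup_add left.add sum.distrib)
  qed
  have g_scale: "g (laurent_scale scale c p) = scaleC c (g p)" for c p
  proof -
    have "Poly_Mapping.keys (laurent_scale scale c p) \<subseteq> Poly_Mapping.keys p"
      by (auto simp: in_keys_iff lookup_laurent_scale[OF VA])
    from g_sup[OF _ this] show ?thesis
      by (simp add: lookup_laurent_scale[OF VA] left.scale left.vs2.scale_sum_right g_def)
  qed
  have lin: "Vector_Spaces.linear (laurent_scale scale) scaleC g"
    unfolding Vector_Spaces.linear_def module_hom_def module_hom_axioms_def
    using vector_space_laurent[OF VA] VC
    by (auto simp: g_add g_scale module_iff_vector_space)
  have ten: "g (laurent_tensor scale a q) = f a q" for a q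
  proof -
    have "Poly_Mapping.keys (laurent_tensor scale a q) \<subseteq> Poly_Mapping.keys q"
      by (auto simp: in_keys_iff lookup_laurent_tensor[OF VA])
    from g_sup[OF _ this]
    have "g (laurent_tensor scale a q) =
        (\<Sum>m\<in>Poly_Mapping.keys q. scaleC (Poly_Mapping.lookup q m) (f a (laurent_monom 1 m)))"
      by (simp add: lookup_laurent_tensor[OF VA] left.scale)
    also have "\<dots> = (\<Sum>m\<in>Poly_Mapping.keys q. f a (laurent_monom (Poly_Mapping.lookup q m) m))"
    proof (rule sum.cong)
      fix m
      have "laurent_monom (Poly_Mapping.lookup q m) m
          = laurent_scale (*) (Poly_Mapping.lookup q m) (laurent_monom 1 m)"
        by (auto intro!: poly_mapping_eqI
            simp: lookup_laurent_scale[OF K] laurent_monom_def lookup_single when_def)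
      then show "scaleC (Poly_Mapping.lookup q m) (f a (laurent_monom 1 m))
          = f a (laurent_monom (Poly_Mapping.lookup q m) m)"
        by (simp add: right.scale)
    qed simp
    also have "\<dots> = f a q"
      using right.sum[of a "\<lambda>m. laurent_monom (Poly_Mapping.lookup q m) m" "Poly_Mapping.keys q"]
      by (simp flip: laurent_eq_sum_monom)
    finally show ?thesis .
  qed
  show ?thesis
  proof (intro ex1I[of _ g] conjI allI lin ten)
    fix h
    assume h: "Vector_Spaces.linear (laurent_scale scale) scaleC h \<and>
      (\<forall>a q. h (laurent_tensor scale a q) = f a q)"
    then interpret h: Vector_Spaces.linear "laurent_scale scale" scaleC h by simp
    have "h p = g p" for p
    proof -
      have "h p = (\<Sum>m\<in>Poly_Mapping.keys p. h (laurent_monom (Poly_Mapping.lookup p m) m))"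
        by (subst laurent_eq_sum_monom) (rule h.sum)
      also have "\<dots> = g p"
        unfolding g_def using h by (auto simp flip: laurent_tensor_monom[OF VA])
      finally show ?thesis .
    qed
    then show "h = g" ..
  qed
qed

lemma laurent_mult_monom:
  assumes "bilinear_operation scale mul"
  shows "laurent_mult mul (laurent_monom a m) (laurent_monom b n) = laurent_monom (mul a b) (m + n)"
proof -
  interpret bilinear_operation scale mul by fact
  interpret r: Vector_Spaces.linear scale scale "\<lambda>y. mul x y" for x by (rule linear_right)
  interpret l: Vector_Spaces.linear scale scale "\<lambda>x. mul x y" for y by (rule linear_left)
  show ?thesis
    by (auto simp: laurent_mult_def laurent_monom_def l.zero r.zero)
qed

lemma laurent_bracket_monom:
  assumes "bilinear_operation scale nov"
  shows "laurent_bracket scale nov (laurent_monom a m) (laurent_monom b n) =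
      laurent_scale scale (of_int m) (laurent_monom (nov a b) (m + n - 1))
    - laurent_scale scale (of_int n) (laurent_monom (nov b a) (m + n - 1))"
proof -
  interpret bilinear_operation scale nov by fact
  interpret r: Vector_Spaces.linear scale scale "\<lambda>y. nov x y" for x by (rule linear_right)
  interpret l: Vector_Spaces.linear scale scale "\<lambda>x. nov x y" for y by (rule linear_left)
  interpret L: vector_space "laurent_scale scale"
    by (rule vector_space_laurent) unfold_locales
  show ?thesis
    by (auto simp: laurent_bracket_def laurent_monom_def l.zero r.zero)
qed

lemma bilinear_laurent_extension:
  fixes B :: "int \<Rightarrow> int \<Rightarrow> 'a::ab_group_add \<Rightarrow> 'a \<Rightarrow> 'a laurent"
  assumes V: "vector_space scale"
    and right: "\<And>m n x. Vector_Spaces.linear scale (laurent_scale scale) (\<lambda>y. B m n x y)"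
    and left: "\<And>m n y. Vector_Spaces.linear scale (laurent_scale scale) (\<lambda>x. B m n x y)"
  shows "bilinear_operation (laurent_scale scale)
    (\<lambda>p q. \<Sum>m\<in>Poly_Mapping.keys p. \<Sum>n\<in>Poly_Mapping.keys q.
       B m n (Poly_Mapping.lookup p m) (Poly_Mapping.lookup q n))"
    (is "bilinear_operation _ ?F")
proof -
  interpret r: Vector_Spaces.linear scale "laurent_scale scale" "\<lambda>y. B m n x y" for m n x
    by (rule right)
  interpret l: Vector_Spaces.linear scale "laurent_scale scale" "\<lambda>x. B m n x y" for m n y
    by (rule left)
  have sup: "?F p q = (\<Sum>m\<in>S. \<Sum>n\<in>T. B m n (Poly_Mapping.lookup p m) (Poly_Mapping.lookup q n))"
    if "finite S" "finite T" "Poly_Mapping.keys p \<subseteq> S" "Poly_Mapping.keys q \<subseteq> T" for p q S T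
  proof -
    have "?F p q = (\<Sum>m\<in>Poly_Mapping.keys p. \<Sum>n\<in>T. B m n (Poly_Mapping.lookup p m) (Poly_Mapping.lookup q n))"
      by (intro sum.cong sum.mono_neutral_left refl) (use that in \<open>auto simp: in_keys_iff r.zero\<close>)
    also have "\<dots> = (\<Sum>m\<in>S. \<Sum>n\<in>T. B m n (Poly_Mapping.lookup p m) (Poly_Mapping.lookup q n))"
      by (intro sum.mono_neutral_left) (use that in \<open>auto simp: in_keys_iff l.zero\<close>)
    finally show ?thesis .
  qed
  have keys_scale: "Poly_Mapping.keys (laurent_scale scale c p) \<subseteq> Poly_Mapping.keys p" for c p
    by (auto simp: in_keys_iff lookup_laurent_scale[OF V] r.vs1.scale_zero_right)
  have add_right: "?F p (q + q') = ?F p q + ?F p q'" for p q q'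
  proof -
    let ?T = "Poly_Mapping.keys q \<union> Poly_Mapping.keys q'"
    have "finite ?T" by simp
    note * = sup[OF finite_keys[of p] this order_refl]
    show ?thesis
      unfolding *[of q, OF Un_upper1] *[of q', OF Un_upper2] *[of "q + q'", OF keys_add]
      by (simp add: lookup_add r.add sum.distrib)
  qed
  have add_left: "?F (p + p') q = ?F p q + ?F p' q" for p p' q
  proof -
    let ?S = "Poly_Mapping.keys p \<union> Poly_Mapping.keys p'"
    have "finite ?S" by simp
    note * = sup[OF this finite_keys[of q] _ order_refl]
    show ?thesis
      unfolding *[of p, OF Un_upper1] *[of p', OF Un_upper2] *[of "p + p'", OF keys_add]
      by (simp add: lookup_add l.add sum.distrib)
  qed
  have scale_right: "?F p (laurent_scale scale c q) = laurent_scale scale c (?F p q)" for c p q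
    using sup[OF finite_keys[of p] finite_keys[of q] order_refl keys_scale]
    by (simp add: lookup_laurent_scale[OF V] r.scale r.vs2.scale_sum_right)
  have scale_left: "?F (laurent_scale scale c p) q = laurent_scale scale c (?F p q)" for c p q
    using sup[OF finite_keys[of p] finite_keys[of q] keys_scale order_refl]
    by (simp add: lookup_laurent_scale[OF V] l.scale r.vs2.scale_sum_right)
  show ?thesis
    unfolding bilinear_operation_def bilinear_operation_axioms_def
      Vector_Spaces.linear_def module_hom_def module_hom_axioms_def module_iff_vector_space
    using vector_space_laurent[OF V] add_right add_left scale_right scale_left by blast
qed

lemma bilinear_laurent_mult:
  assumes "bilinear_operation scale mul"
  shows "bilinear_operation (laurent_scale scale) (laurent_mult mul)"
proof -
  interpret bilinear_operation scale mul by fact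
  interpret r: Vector_Spaces.linear scale scale "\<lambda>y. mul x y" for x by (rule linear_right)
  interpret l: Vector_Spaces.linear scale scale "\<lambda>x. mul x y" for y by (rule linear_left)
  have V: "vector_space scale" by unfold_locales
  show ?thesis
    unfolding laurent_mult_def
    by (rule bilinear_laurent_extension[OF V])
      (auto simp: Vector_Spaces.linear_def module_hom_def module_hom_axioms_def
        module_iff_vector_space V vector_space_laurent[OF V] laurent_monom_def l.add r.add
        l.scale r.scale single_add lookup_laurent_scale[OF V] lookup_single when_def
        intro!: poly_mapping_eqI)
qed

lemma bilinear_laurent_bracket:
  assumes "bilinear_operation scale nov"
  shows "bilinear_operation (laurent_scale scale) (laurent_bracket scale nov)"
proof -
  interpret bilinear_operation scale nov by fact
  interpret r: Vector_Spaces.linear scale scale "\<lambda>y. nov x y" for x by (rule linear_right)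
  interpret l: Vector_Spaces.linear scale scale "\<lambda>x. nov x y" for y by (rule linear_left)
  have V: "vector_space scale" by unfold_locales
  show ?thesis
    unfolding laurent_bracket_def
    by (rule bilinear_laurent_extension[OF V])
      (auto simp: Vector_Spaces.linear_def module_hom_def module_hom_axioms_def
        module_iff_vector_space V vector_space_laurent[OF V] laurent_monom_def l.add r.add
        l.scale r.scale lookup_add lookup_minus lookup_laurent_scale[OF V] lookup_single when_def
        scale_right_distrib scale_right_diff_distrib mult.commute
        intro!: poly_mapping_eqI)
qed

end

theory Submission
  imports Defs
begin

text \<open>
  The law \<open>[p, p] = 0\<close> holds for every bilinear \<open>\<circ>\<close> (\<open>laurent_bracket_self\<close>). All other axioms of a
  Jacobi algebra are multiadditive identities, so on \<open>A[t, t\<^sup>-\<^sup>1]\<close> they hold as soon as they hold on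
  monomials \<open>a t\<^sup>m\<close> (\<open>additive_eq_on_monomials\<close>, \<open>triadditive_eq_on_monomials\<close>). For the unital
  commutative algebra this is immediate. For the other two, the defect on monomials is
  again a monomial, whose coefficient is a polynomial in the exponents with values in \<open>A\<close>; the
  coefficients of this polynomial are defects of axioms of a Jacobi Novikov-Poisson algebra:

  \<^item> The defect of the Jacobi identity for \<open>a t\<^sup>m, b t\<^sup>n, c t\<^sup>k\<close> (\<open>bracket_jacobi_monom\<close>) is a combination
    of \<open>m n\<close>, \<open>n k\<close>, \<open>k m\<close> with left-symmetry defects as coefficients, and of \<open>m (m - 1)\<close>,
    \<open>n (n - 1)\<close>, \<open>k (k - 1)\<close> with right-commutativity defects as coefficients.
  \<^item> The defect of the Jacobi algebra's Leibniz rule (\<open>leibniz_monom\<close>) is linear in \<open>m, n, k\<close>; the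
    coefficient of \<open>m\<close> is the defect of the rule for \<open>c \<circ> (a \<cdot> b)\<close>, and those of \<open>n\<close> and \<open>k\<close> are
    defects of \<open>(a \<cdot> b) \<circ> c = a \<cdot> (b \<circ> c)\<close>, up to commutativity.

  Hence the axioms on \<open>A\<close> make all defects vanish. Conversely, small exponents isolate the
  coefficients one by one: \<open>(1, 1, 0)\<close> kills every \<open>x (x - 1)\<close> and leaves left symmetry,
  and \<open>(0, -1, 0)\<close> leaves twice the right-commutativity defect. This factor \<open>2\<close>
  is where the characteristic enters.
\<close>

section \<open>Laurent monomials\<close>

lemma lookup_laurent_monom: "Poly_Mapping.lookup (laurent_monom a m) n = (if m = n then a else 0)"
  by (simp add: laurent_monom_def lookup_single when_def)

lemma laurent_monom_eq_iff [simp]: "laurent_monom a m = laurent_monom b m \<longleftrightarrow> a = b"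
  by (metis lookup_laurent_monom)

lemma laurent_monom_zero [simp]: "laurent_monom 0 m = 0"
  by (simp add: laurent_monom_def)

lemma laurent_monom_add: "laurent_monom (a + b) m = laurent_monom a m + laurent_monom b m"
  by (simp add: laurent_monom_def single_add)

lemma laurent_monom_diff:
  "laurent_monom (a - b) m = laurent_monom a m - laurent_monom (b :: 'a::ab_group_add) m"
  by (simp add: laurent_monom_def single_diff)

lemma laurent_scale_monom:
  assumes "vector_space scale"
  shows "laurent_scale scale c (laurent_monom a m) = laurent_monom (scale c a) m"
proof -
  interpret vector_space scale by fact
  show ?thesis
    by (rule poly_mapping_eqI) (simp add: lookup_laurent_scale[OF assms] lookup_laurent_monom)
qed

lemma additive_eq_on_monomials:
  fixes F G :: "'a::ab_group_add laurent \<Rightarrow> 'b::ab_group_add"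
  assumes F: "\<And>p q. F (p + q) = F p + F q" and G: "\<And>p q. G (p + q) = G p + G q"
    and eq: "\<And>a m. F (laurent_monom a m) = G (laurent_monom a m)"
  shows "F p = G p"
proof -
  interpret F: additive F by standard (rule F)
  interpret G: additive G by standard (rule G)
  show ?thesis
    by (subst (1 2) laurent_eq_sum_monom) (simp add: F.sum G.sum eq)
qed

lemma triadditive_eq_on_monomials:
  fixes F G :: "'a::ab_group_add laurent \<Rightarrow> 'a laurent \<Rightarrow> 'a laurent \<Rightarrow> 'b::ab_group_add"
  assumes "\<And>p p' q r. F (p + p') q r = F p q r + F p' q r"
    and "\<And>p q q' r. F p (q + q') r = F p q r + F p q' r"
    and "\<And>p q r r'. F p q (r + r') = F p q r + F p q r'"
    and "\<And>p p' q r. G (p + p') q r = G p q r + G p' q r"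
    and "\<And>p q q' r. G p (q + q') r = G p q r + G p q' r"
    and "\<And>p q r r'. G p q (r + r') = G p q r + G p q r'"
    and eq: "\<And>a b c m n k. F (laurent_monom a m) (laurent_monom b n) (laurent_monom c k)
      = G (laurent_monom a m) (laurent_monom b n) (laurent_monom c k)"
  shows "F p q r = G p q r"
proof -
  have 1: "F (laurent_monom a m) (laurent_monom b n) r = G (laurent_monom a m) (laurent_monom b n) r"
    for a b m n r
    by (rule additive_eq_on_monomials) (fact assms)+
  have 2: "F (laurent_monom a m) q r = G (laurent_monom a m) q r" for a m q r
    by (rule additive_eq_on_monomials[of "\<lambda>q. F _ q _"]) (fact assms 1)+
  show ?thesis
    by (rule additive_eq_on_monomials[of "\<lambda>p. F p _ _"]) (fact assms 2)+
qed

section \<open>The algebra of Laurent polynomials\<close>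

context bilinear_operation
begin

lemma module_hom_right: "module_hom scale scale (\<lambda>y. f x y)"
  using linear_right[of x] by (simp add: Vector_Spaces.linear_def)

lemma module_hom_left: "module_hom scale scale (\<lambda>x. f x y)"
  using linear_left[of y] by (simp add: Vector_Spaces.linear_def)

lemmas add_right = module_hom.add[OF module_hom_right]
  and add_left = module_hom.add[OF module_hom_left]
  and scale_right = module_hom.scale[OF module_hom_right]
  and scale_left = module_hom.scale[OF module_hom_left]
  and minus_right = module_hom.neg[OF module_hom_right]
  and diff_right = module_hom.diff[OF module_hom_right]
  and diff_left = module_hom.diff[OF module_hom_left]

end

lemma unital_comm_algebra_laurent_iff:
  assumes mul: "bilinear_operation scale mul"
  shows "unital_comm_algebra (laurent_scale scale) (laurent_mult mul) (laurent_monom one 0)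
    \<longleftrightarrow> unital_comm_algebra scale mul one"
proof
  note monom = laurent_mult_monom[OF mul]
  assume "unital_comm_algebra (laurent_scale scale) (laurent_mult mul) (laurent_monom one 0)"
  then interpret L: unital_comm_algebra "laurent_scale scale" "laurent_mult mul" "laurent_monom one 0" .
  show "unital_comm_algebra scale mul one"
  proof (intro unital_comm_algebra.intro mul unital_comm_algebra_axioms.intro)
    fix a b c
    show "mul (mul a b) c = mul a (mul b c)"
      using L.mul_assoc[of "laurent_monom a 0" "laurent_monom b 0" "laurent_monom c 0"]
      by (simp add: monom)
    show "mul a b = mul b a"
      using L.mul_comm[of "laurent_monom a 0" "laurent_monom b 0"] by (simp add: monom)
    show "mul one a = a"
      using L.mul_one[of "laurent_monom a 0"] by (simp add: monom)
  qed
next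
  note monom = laurent_mult_monom[OF mul]
  assume "unital_comm_algebra scale mul one"
  then interpret unital_comm_algebra scale mul one .
  interpret L: bilinear_operation "laurent_scale scale" "laurent_mult mul"
    by (rule bilinear_laurent_mult[OF mul])
  note add = L.add_left L.add_right
  show "unital_comm_algebra (laurent_scale scale) (laurent_mult mul) (laurent_monom one 0)"
  proof (intro unital_comm_algebra.intro L.bilinear_operation_axioms unital_comm_algebra_axioms.intro)
    fix p q r
    show "laurent_mult mul (laurent_mult mul p q) r = laurent_mult mul p (laurent_mult mul q r)"
      by (rule triadditive_eq_on_monomials) (simp_all add: add monom mul_assoc add.assoc)
    show "laurent_mult mul p q = laurent_mult mul q p"
    proof (rule additive_eq_on_monomials[of _ _ p])
      fix a m
      show "laurent_mult mul (laurent_monom a m) q = laurent_mult mul q (laurent_monom a m)"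
        by (rule additive_eq_on_monomials[of _ _ q]) (simp_all add: add monom mul_comm add.commute)
    qed (simp_all add: add)
    show "laurent_mult mul (laurent_monom one 0) p = p"
      by (rule additive_eq_on_monomials[of _ _ p]) (simp_all add: add monom mul_one)
  qed
qed

section \<open>The Lie bracket and the Novikov axioms\<close>

lemma laurent_bracket_monom_eq_monom:
  assumes nov: "bilinear_operation scale nov"
  shows "laurent_bracket scale nov (laurent_monom a m) (laurent_monom b n) =
    laurent_monom (scale (of_int m) (nov a b) - scale (of_int n) (nov b a)) (m + n - 1)"
proof -
  interpret bilinear_operation scale nov by fact
  show ?thesis
    by (simp add: laurent_bracket_monom[OF nov] laurent_scale_monom[OF vector_space_axioms]
        laurent_monom_diff)
qed

text \<open>
  The bracket is alternating for every bilinear operation: the diagonal double sum is of the form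
  \<open>\<Sum>m n. T m n - T n m\<close>.
\<close>

lemma laurent_bracket_self: "laurent_bracket scale nov p p = 0"
proof -
  let ?T = "\<lambda>m n. laurent_scale scale (of_int m)
    (laurent_monom (nov (Poly_Mapping.lookup p m) (Poly_Mapping.lookup p n)) (m + n - 1))"
  let ?K = "Poly_Mapping.keys p"
  have "laurent_bracket scale nov p p = (\<Sum>m\<in>?K. \<Sum>n\<in>?K. ?T m n) - (\<Sum>m\<in>?K. \<Sum>n\<in>?K. ?T n m)"
    by (simp add: laurent_bracket_def sum_subtractf add.commute)
  also have "(\<Sum>m\<in>?K. \<Sum>n\<in>?K. ?T n m) = (\<Sum>m\<in>?K. \<Sum>n\<in>?K. ?T m n)"
    by (rule sum.swap)
  finally show ?thesis by simp
qed

text \<open>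
  The linear terms in the exponents come from the shift in \<open>t\<^sup>m\<^sup>+\<^sup>n\<^sup>-\<^sup>1\<close>; they carry the same
  coefficients as the squares, up to sign, which is why only the products \<open>x (x - 1)\<close> appear.
\<close>

lemma bracket_jacobi_monom:
  fixes scale :: "'k::field \<Rightarrow> 'a::ab_group_add \<Rightarrow> 'a" and nov :: "'a \<Rightarrow> 'a \<Rightarrow> 'a"
  assumes nov: "bilinear_operation scale nov"
  defines "br \<equiv> laurent_bracket scale nov"
    and "ls \<equiv> \<lambda>a b c. nov (nov b a) c - nov b (nov a c) - (nov (nov a b) c - nov a (nov b c))"
    and "rc \<equiv> \<lambda>a b c. nov (nov a c) b - nov (nov a b) c"
  shows "br (laurent_monom a m) (br (laurent_monom b n) (laurent_monom c k))
      + br (laurent_monom b n) (br (laurent_monom c k) (laurent_monom a m))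
      + br (laurent_monom c k) (br (laurent_monom a m) (laurent_monom b n)) =
    laurent_monom
      (scale (of_int (m * n)) (ls a b c) + scale (of_int (n * k)) (ls b c a)
        + scale (of_int (k * m)) (ls c a b)
        + scale (of_int (m * (m - 1))) (rc a b c) + scale (of_int (n * (n - 1))) (rc b c a)
        + scale (of_int (k * (k - 1))) (rc c a b))
      (m + n + k - 2)"
proof -
  interpret bilinear_operation scale nov by fact
  have e: "m + (n + k - 1) - 1 = m + n + k - 2" "n + (k + m - 1) - 1 = m + n + k - 2"
    "k + (m + n - 1) - 1 = m + n + k - 2"
    by simp_all
  show ?thesis
    unfolding br_def laurent_bracket_monom_eq_monom[OF nov] e laurent_monom_add[symmetric]
      laurent_monom_eq_iff ls_def rc_def
    by (simp add: diff_left diff_right add_left add_right scale_left scale_right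
        scale_right_diff_distrib scale_left_diff_distrib scale_right_distrib scale_left_distrib
        algebra_simps)
qed

lemma lie_algebra_laurent_iff:
  fixes scale :: "'k::field_char_0 \<Rightarrow> 'a::ab_group_add \<Rightarrow> 'a"
  assumes nov: "bilinear_operation scale nov"
  shows "lie_algebra (laurent_scale scale) (laurent_bracket scale nov) \<longleftrightarrow> novikov_algebra scale nov"
proof
  note jacobi = bracket_jacobi_monom[OF nov]
  interpret bilinear_operation scale nov by fact
  assume "lie_algebra (laurent_scale scale) (laurent_bracket scale nov)"
  then interpret L: lie_algebra "laurent_scale scale" "laurent_bracket scale nov" .
  show "novikov_algebra scale nov"
  proof (intro novikov_algebra.intro nov novikov_algebra_axioms.intro)
    fix a b c
    show "nov (nov a b) c - nov a (nov b c) = nov (nov b a) c - nov b (nov a c)"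
      using L.jacobi_identity[of "laurent_monom a 1" "laurent_monom b 1" "laurent_monom c 0"]
      unfolding jacobi laurent_monom_zero[symmetric, of "1 + 1 + 0 - 2"] laurent_monom_eq_iff
      by simp
    \<comment> \<open>With exponents \<open>0, 1, 0\<close> the factor \<open>n (n - 1)\<close> would vanish; \<open>n = -1\<close> makes it \<open>2\<close>.\<close>
    have "scale 2 (nov (nov a b) c - nov (nov a c) b) = 0"
      using L.jacobi_identity[of "laurent_monom c 0" "laurent_monom a (-1)" "laurent_monom b 0"]
      unfolding jacobi laurent_monom_zero[symmetric, of "0 + (-1) + 0 - 2"] laurent_monom_eq_iff
      by simp
    then show "nov (nov a b) c = nov (nov a c) b"
      by (simp add: scale_eq_0_iff)
  qed
next
  note jacobi = bracket_jacobi_monom[OF nov]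
  assume "novikov_algebra scale nov"
  then interpret novikov_algebra scale nov .
  interpret L: bilinear_operation "laurent_scale scale" "laurent_bracket scale nov"
    by (rule bilinear_laurent_bracket[OF nov])
  note add = L.add_left L.add_right
  let ?br = "laurent_bracket scale nov"
  have rc: "nov (nov a c) b - nov (nov a b) c = 0" for a b c
    using right_commutative by simp
  have ls: "nov (nov b a) c - nov b (nov a c) - (nov (nov a b) c - nov a (nov b c)) = 0" for a b c
    using left_symmetric by simp
  show "lie_algebra (laurent_scale scale) ?br"
  proof (intro lie_algebra.intro L.bilinear_operation_axioms lie_algebra_axioms.intro)
    fix p q r
    show "?br p p = 0" by (rule laurent_bracket_self)
    show "?br p (?br q r) + ?br q (?br r p) + ?br r (?br p q) = 0"
      by (rule triadditive_eq_on_monomials[where G = "\<lambda>_ _ _. 0"])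
        (simp_all add: jacobi rc ls, simp_all add: add algebra_simps)
  qed
qed

section \<open>The Leibniz rule\<close>

lemma leibniz_monom:
  fixes scale :: "'k::field \<Rightarrow> 'a::ab_group_add \<Rightarrow> 'a" and mul nov :: "'a \<Rightarrow> 'a \<Rightarrow> 'a"
  assumes mul: "bilinear_operation scale mul" and nov: "bilinear_operation scale nov"
  defines "br \<equiv> laurent_bracket scale nov" and "mu \<equiv> laurent_mult mul"
  shows "br (laurent_monom a m) (mu (laurent_monom b n) (laurent_monom c k))
      - (mu (br (laurent_monom a m) (laurent_monom b n)) (laurent_monom c k)
        + mu (laurent_monom b n) (br (laurent_monom a m) (laurent_monom c k))
        + mu (mu (laurent_monom b n) (laurent_monom c k))
            (br (laurent_monom one 0) (laurent_monom a m))) =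
    laurent_monom
      (scale (of_int m) (nov a (mul b c)
          - (mul (nov a b) c + mul b (nov a c) - mul (mul b c) (nov a one)))
        - scale (of_int n) (nov (mul b c) a - mul (nov b a) c)
        - scale (of_int k) (nov (mul b c) a - mul b (nov c a)))
      (m + n + k - 1)"
proof -
  interpret mul: bilinear_operation scale mul by fact
  interpret nov: bilinear_operation scale nov by fact
  have e: "m + (n + k) - 1 = m + n + k - 1" "m + n - 1 + k = m + n + k - 1"
    "n + (m + k - 1) = m + n + k - 1" "n + k + (0 + m - 1) = m + n + k - 1"
    by simp_all
  show ?thesis
    unfolding br_def mu_def laurent_bracket_monom_eq_monom[OF nov] laurent_mult_monom[OF mul] e
      laurent_monom_add[symmetric] laurent_monom_diff[symmetric] laurent_monom_eq_iff
    by (simp add: mul.diff_left mul.diff_right mul.minus_right mul.scale_left mul.scale_right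
        mul.scale_right_diff_distrib mul.scale_left_diff_distrib mul.scale_right_distrib
        mul.scale_left_distrib algebra_simps)
qed

text \<open>
  The coefficients of \<open>n\<close> and \<open>k\<close> express \<open>(b \<cdot> c) \<circ> a\<close> through \<open>b \<circ> a\<close> and through \<open>c \<circ> a\<close>;
  commutativity of \<open>\<cdot>\<close> makes these the same axiom with \<open>b\<close> and \<open>c\<close> exchanged.
\<close>

lemma leibniz_laurent_iff:
  fixes scale :: "'k::field \<Rightarrow> 'a::ab_group_add \<Rightarrow> 'a" and mul nov :: "'a \<Rightarrow> 'a \<Rightarrow> 'a"
  assumes mul: "bilinear_operation scale mul" and nov: "bilinear_operation scale nov"
    and comm: "\<And>a b. mul a b = mul b a"
  defines "br \<equiv> laurent_bracket scale nov" and "mu \<equiv> laurent_mult mul"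
  shows "(\<forall>p q r. br p (mu q r) =
        mu (br p q) r + mu q (br p r) + mu (mu q r) (br (laurent_monom one 0) p))
    \<longleftrightarrow> (\<forall>a b c. nov (mul a b) c = mul a (nov b c))
      \<and> (\<forall>a b c. nov c (mul a b) = mul (nov c a) b + mul a (nov c b) - mul (mul a b) (nov c one))"
    (is "?L \<longleftrightarrow> ?R")
proof
  interpret mul: bilinear_operation scale mul by fact
  assume L: ?L
  have 0: "scale (of_int m) (nov a (mul b c)
          - (mul (nov a b) c + mul b (nov a c) - mul (mul b c) (nov a one)))
        - scale (of_int n) (nov (mul b c) a - mul (nov b a) c)
        - scale (of_int k) (nov (mul b c) a - mul b (nov c a)) = 0" for m n k a b c
    using leibniz_monom[OF mul nov, of a m b n c k one] L
    unfolding br_def mu_def by (metis (no_types, lifting) diff_self laurent_monom_zero laurent_monom_eq_iff)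
  show ?R
    using 0[where m = 0 and n = 0 and k = 1] 0[where m = 1 and n = 0 and k = 0] by simp
next
  interpret Mu: bilinear_operation "laurent_scale scale" mu
    unfolding mu_def by (rule bilinear_laurent_mult[OF mul])
  interpret Br: bilinear_operation "laurent_scale scale" br
    unfolding br_def by (rule bilinear_laurent_bracket[OF nov])
  interpret mul: bilinear_operation scale mul by fact
  note add = Mu.add_left Mu.add_right Br.add_left Br.add_right
  assume R: ?R
  then have left: "nov (mul b c) a = mul (nov b a) c" for a b c
    by (metis comm)
  have monom: "br (laurent_monom a m) (mu (laurent_monom b n) (laurent_monom c k)) =
      mu (br (laurent_monom a m) (laurent_monom b n)) (laurent_monom c k)
      + mu (laurent_monom b n) (br (laurent_monom a m) (laurent_monom c k))
      + mu (mu (laurent_monom b n) (laurent_monom c k))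
          (br (laurent_monom one 0) (laurent_monom a m))" for a b c m n k
    using leibniz_monom[OF mul nov, of a m b n c k one] R left[of b c a]
    unfolding br_def[symmetric] mu_def[symmetric] by simp
  show ?L
  proof (intro allI)
    fix p q r
    show "br p (mu q r) = mu (br p q) r + mu q (br p r) + mu (mu q r) (br (laurent_monom one 0) p)"
      by (rule triadditive_eq_on_monomials) (fact monom | simp add: add algebra_simps)+
  qed
qed

section \<open>The characterisation\<close>

theorem theorem2p8:
  fixes scale :: "'k::field_char_0 \<Rightarrow> 'a::ab_group_add \<Rightarrow> 'a"
    and mul nov :: "'a \<Rightarrow> 'a \<Rightarrow> 'a"
    and one :: 'a
  assumes "vector_space scale"
    and "bilinear_operation scale mul"
    and "bilinear_operation scale nov"
  shows "jacobi_algebra (laurent_scale scale) (laurent_mult mul) (laurent_bracket scale nov)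
           (laurent_tensor scale one (laurent_monom 1 0))
    \<longleftrightarrow> jacobi_novikov_poisson_algebra scale mul nov one"
proof -
  note leibniz = leibniz_laurent_iff[OF assms(2,3), of one]
  show ?thesis
    unfolding jacobi_algebra_def jacobi_algebra_axioms_def jacobi_novikov_poisson_algebra_def
      jacobi_novikov_poisson_algebra_axioms_def laurent_tensor_monom[OF assms(1)]
      unital_comm_algebra_laurent_iff[OF assms(2)] lie_algebra_laurent_iff[OF assms(3)]
    using leibniz unital_comm_algebra.mul_comm[of scale mul one]
    by blast
qed

end
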